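(* For every fixed location profile $\boldsymbol{d}\in\Delta^N$, the spatial channel selection game on the interference graph $G_{\boldsymbol{d}}$ (players $\mathcal{N}$, action set $\mathcal{M}$ for each player, payoff of player $n$ equal to $U_n(\boldsymbol{d},\boldsymbol{a})$) has a Nash equilibrium and the finite improvement property.
   Context: Users $\mathcal{N}=\{1,\dots,N\}$; channels $\mathcal{M}=\{1,\dots,M\}$; $\Delta$ is a finite set of locations with a distance $\|\cdot,\cdot\|$; $\delta$ is the transmission range. For $\boldsymbol{d}=(d_1,\dots,d_N)\in\Delta^N$, the interference graph $G_{\boldsymbol{d}}$ is the undirected graph on $\mathcal{N}$ with an edge between distinct $i,j$ iff $\|d_i,d_j\|\le\delta$; $\mathcal{N}_n(\boldsymbol{d})$ is the set of neighbors of $n$. Parameters: $\theta_m\in(0,1)$; mean data rates $B_{m,d}^n>0$; fixed contention probabilities $p_n\in(p_{\min},p_{\max})$ with $0<p_{\min}<p_{\max}<1$. For $\boldsymbol{a}\in\mathcal{M}^N$, $\mathcal{N}_n^{a_n}(\boldsymbol{d},\boldsymbol{a})=\{i\in\mathcal{N}_n(\boldsymbol{d}):a_i=a_n\}$, and $$U_n(\boldsymbol{d},\boldsymbol{a})=\log\Big(\theta_{a_n}B_{a_n,d_n}^n p_n\prod_{i\in\mathcal{N}_n^{a_n}(\boldsymbol{d},\boldsymbol{a})}(1-p_i)\Big).$$ A Nash equilibrium is a profile $\boldsymbol{a}^*\in\mathcal{M}^N$ with $a_n^*\in\arg\max_{a_n\in\mathcal{M}}U_n(\boldsymbol{d},a_n,a_{-n}^*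 )$ for all $n$. A better response update is a change by a single player $n$ from action $a_n$ to $a_n'$ with $U_n(\boldsymbol{d},a_n',a_{-n})>U_n(\boldsymbol{d},a_n,a_{-n})$. The finite improvement property: any asynchronous better response update process (no more than one player updates at any given time) terminates at a pure Nash equilibrium within a finite number of updates. *)

theory Defs
  imports "HOL-Analysis.Analysis"
begin

text \<open>
  A strategic game is given by a player set \<open>I\<close>, action sets \<open>A i\<close> and payoffs
  \<open>u i\<close>. Profiles are the extensional functions \<open>Pi\<^sub>E I A\<close>, so that two profiles
  are equal iff all players use the same actions.
\<close>

definition nash_equilibrium ::
  "'i set \<Rightarrow> ('i \<Rightarrow> 'a set) \<Rightarrow> ('i \<Rightarrow> ('i \<Rightarrow> 'a) \<Rightarrow> real) \<Rightarrow> ('i \<Rightarrow> 'a) \<Rightarrow> bool" where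
  "nash_equilibrium I A u a \<longleftrightarrow>
     a \<in> Pi\<^sub>E I A \<and>
     (\<forall>n\<in>I. is_arg_max (\<lambda>x. u n (a(n := x))) (\<lambda>x. x \<in> A n) (a n))"

definition better_response_update ::
  "'i set \<Rightarrow> ('i \<Rightarrow> 'a set) \<Rightarrow> ('i \<Rightarrow> ('i \<Rightarrow> 'a) \<Rightarrow> real) \<Rightarrow> ('i \<Rightarrow> 'a) \<Rightarrow> ('i \<Rightarrow> 'a) \<Rightarrow> bool" where
  "better_response_update I A u a b \<longleftrightarrow>
     a \<in> Pi\<^sub>E I A \<and> (\<exists>n\<in>I. \<exists>x\<in>A n. b = a(n := x) \<and> u n b > u n a)"

text \<open>At most one player updates at any given time; steps without an update are allowed.\<close>

definition async_better_response_process ::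
  "'i set \<Rightarrow> ('i \<Rightarrow> 'a set) \<Rightarrow> ('i \<Rightarrow> ('i \<Rightarrow> 'a) \<Rightarrow> real) \<Rightarrow> (nat \<Rightarrow> 'i \<Rightarrow> 'a) \<Rightarrow> bool" where
  "async_better_response_process I A u s \<longleftrightarrow>
     s 0 \<in> Pi\<^sub>E I A \<and>
     (\<forall>t. s (Suc t) = s t \<or> better_response_update I A u (s t) (s (Suc t)))"

definition update_times :: "(nat \<Rightarrow> 'i \<Rightarrow> 'a) \<Rightarrow> nat set" where
  "update_times s = {t. s (Suc t) \<noteq> s t}"

text \<open>
  The process does not come to rest while some player still has a better response.
  Without this, a process that merely idles would count as a process that has
  stopped outside an equilibrium.
\<close>

definition never_stalls ::
  "'i set \<Rightarrow> ('i \<Rightarrow> 'a set) \<Rightarrow> ('i \<Rightarrow> ('i \<Rightarrow> 'a) \<Rightarrow> real) \<Rightarrow> (nat \<Rightarrow> 'i \<Rightarrow> 'a) \<Rightarrow> bool" where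
  "never_stalls I A u s \<longleftrightarrow>
     (\<forall>t. (\<exists>b. better_response_update I A u (s t) b) \<longrightarrow> (\<exists>t'\<ge>t. t' \<in> update_times s))"

definition finite_improvement_property ::
  "'i set \<Rightarrow> ('i \<Rightarrow> 'a set) \<Rightarrow> ('i \<Rightarrow> ('i \<Rightarrow> 'a) \<Rightarrow> real) \<Rightarrow> bool" where
  "finite_improvement_property I A u \<longleftrightarrow>
     (\<forall>s. async_better_response_process I A u s \<longrightarrow>
        finite (update_times s) \<and>
        (never_stalls I A u s \<longrightarrow>
           (\<exists>T. nash_equilibrium I A u (s T) \<and> (\<forall>t\<ge>T. s t = s T))))"

definition interference_edges ::
  "nat \<Rightarrow> ('l \<Rightarrow> 'l \<Rightarrow> real) \<Rightarrow> real \<Rightarrow> (nat \<Rightarrow> 'l) \<Rightarrow> nat set set" where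
  "interference_edges N ds \<delta> d =
     {{i, j} | i j. i \<in> {1..N} \<and> j \<in> {1..N} \<and> i \<noteq> j \<and> ds (d i) (d j) \<le> \<delta>}"

definition neighbors ::
  "nat \<Rightarrow> ('l \<Rightarrow> 'l \<Rightarrow> real) \<Rightarrow> real \<Rightarrow> (nat \<Rightarrow> 'l) \<Rightarrow> nat \<Rightarrow> nat set" where
  "neighbors N ds \<delta> d n = {i \<in> {1..N}. {n, i} \<in> interference_edges N ds \<delta> d}"

definition cochannel_neighbors ::
  "nat \<Rightarrow> ('l \<Rightarrow> 'l \<Rightarrow> real) \<Rightarrow> real \<Rightarrow> (nat \<Rightarrow> 'l) \<Rightarrow> (nat \<Rightarrow> nat) \<Rightarrow> nat \<Rightarrow> nat set" where
  "cochannel_neighbors N ds \<delta> d a n = {i \<in> neighbors N ds \<delta> d n. a i = a n}"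

text \<open>
  \<open>B m l n\<close> is the mean data rate of user \<open>n\<close> on channel \<open>m\<close> at location \<open>l\<close>.
\<close>

definition payoff ::
  "nat \<Rightarrow> ('l \<Rightarrow> 'l \<Rightarrow> real) \<Rightarrow> real \<Rightarrow> (nat \<Rightarrow> real) \<Rightarrow> (nat \<Rightarrow> 'l \<Rightarrow> nat \<Rightarrow> real) \<Rightarrow>
   (nat \<Rightarrow> real) \<Rightarrow> (nat \<Rightarrow> 'l) \<Rightarrow> nat \<Rightarrow> (nat \<Rightarrow> nat) \<Rightarrow> real" where
  "payoff N ds \<delta> \<theta> B p d n a =
     ln (\<theta> (a n) * B (a n) (d n) n * p n *
         (\<Prod>i\<in>cochannel_neighbors N ds \<delta> d a n. 1 - p i))"

end

theory Submission
  imports Defs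
begin

text \<open>
  With \<open>w i = - ln (1 - p i) > 0\<close> the payoff of player \<open>n\<close> is a private value of the chosen
  channel minus the total weight of the neighbours sharing it. Multiplying by \<open>w n\<close> turns the
  interaction of \<open>i\<close> and \<open>j\<close> into the symmetric term \<open>w i * w j\<close>, so the game has a weighted
  potential; it strictly increases along better responses on a finite set of profiles.
\<close>

text \<open>Payoffs are real, so \<open>is_arg_max\<close> fails at \<open>a n\<close> exactly when
  some action in \<open>A n\<close> pays strictly more; that \<open>a n\<close> itself lies in
  \<open>A n\<close> comes from profile membership. Both existence and convergence thus reduce to
  excluding improving steps.\<close>

lemma nash_equilibrium_iff_no_better_response:
  "nash_equilibrium I A u a \<longleftrightarrow>
     a \<in> Pi\<^sub>E I A \<and> (\<nexists>b. better_response_update I A u a b)"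
  unfolding nash_equilibrium_def better_response_update_def is_arg_max_def
  by (auto simp: PiE_mem)

lemma better_response_update_in_PiE:
  assumes "better_response_update I A u a b"
  shows "b \<in> Pi\<^sub>E I A"
  using assms unfolding better_response_update_def
  by (auto simp: PiE_iff extensional_def)

text \<open>A profile maximising \<Phi> over the finite, nonempty profile set admits no update,
  since an update would lead to a profile with larger \<Phi>.\<close>

lemma nash_equilibrium_exists_of_potential:
  fixes \<Phi> :: "('i \<Rightarrow> 'a) \<Rightarrow> real"
  assumes "finite (Pi\<^sub>E I A)" "Pi\<^sub>E I A \<noteq> {}"
    and incr: "\<And>a b. better_response_update I A u a b \<Longrightarrow> \<Phi> a < \<Phi> b"
  shows "\<exists>a. nash_equilibrium I A u a"
proof -
  have "Max (\<Phi> ` Pi\<^sub>E I A) \<in> \<Phi> ` Pi\<^sub>E I A"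
    using assms(1,2) by (intro Max_in) auto
  then obtain a where "a \<in> Pi\<^sub>E I A" "\<Phi> a = Max (\<Phi> ` Pi\<^sub>E I A)"
    by auto
  then have "a \<in> Pi\<^sub>E I A" "\<And>b. b \<in> Pi\<^sub>E I A \<Longrightarrow> \<not> \<Phi> a < \<Phi> b"
    using assms(1) by (simp_all add: leD)
  then have "nash_equilibrium I A u a"
    using incr better_response_update_in_PiE
    unfolding nash_equilibrium_iff_no_better_response by blast
  then show ?thesis
    by blast
qed

text \<open>Idle steps preserve \<Phi> and updates raise it, so no profile is updated twice;
  finitely many profiles then allow only finitely many updates.\<close>

lemma finite_improvement_property_of_potential:
  fixes \<Phi> :: "('i \<Rightarrow> 'a) \<Rightarrow> real"
  assumes fin: "finite (Pi\<^sub>E I A)"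
    and incr: "\<And>a b. better_response_update I A u a b \<Longrightarrow> \<Phi> a < \<Phi> b"
  shows "finite_improvement_property I A u"
  unfolding finite_improvement_property_def
proof (intro allI impI conjI)
  fix s assume s: "async_better_response_process I A u s"
  have step: "s (Suc t) = s t \<or> better_response_update I A u (s t) (s (Suc t))" for t
    using s unfolding async_better_response_process_def by blast
  have s_in: "s t \<in> Pi\<^sub>E I A" for t
  proof (induction t)
    case 0
    show ?case using s unfolding async_better_response_process_def by blast
  next
    case (Suc t)
    then show ?case using step[of t] better_response_update_in_PiE by metis
  qed
  have "\<Phi> (s t) \<le> \<Phi> (s (Suc t))" for t
    using step[of t] incr by fastforce
  then have mono: "\<Phi> (s t) \<le> \<Phi> (s t')" if "t \<le> t'" for t t'
    using lift_Suc_mono_le[of "\<lambda>t. \<Phi> (s t)"] that by blast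
  have strict: "\<Phi> (s t) < \<Phi> (s t')" if "t \<in> update_times s" "t < t'" for t t'
  proof -
    have "\<Phi> (s t) < \<Phi> (s (Suc t))"
      using step[of t] incr that(1) unfolding update_times_def by auto
    also have "\<dots> \<le> \<Phi> (s t')"
      using mono that(2) by simp
    finally show ?thesis .
  qed
  have "inj_on s (update_times s)"
  proof (rule inj_onI)
    fix t t' assume t: "t \<in> update_times s" "t' \<in> update_times s" and eq: "s t = s t'"
    have "\<not> t < t'"
      using strict[OF t(1), of t'] eq by auto
    moreover have "\<not> t' < t"
      using strict[OF t(2), of t] eq by auto
    ultimately show "t = t'"
      by simp
  qed
  moreover have "finite (s ` update_times s)"
    by (rule finite_subset[OF _ fin]) (simp add: image_subset_iff s_in)
  ultimately show fin_upd: "finite (update_times s)"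
    using finite_imageD by blast
  assume stall: "never_stalls I A u s"
  \<comment> \<open>From \<open>T\<close> on the process is constant. Read contrapositively at
    \<open>T\<close>, \<open>never_stalls\<close> says that no better response is left
    there.\<close>
  obtain T where T: "\<forall>t\<in>update_times s. t < T"
    using fin_upd finite_nat_set_iff_bounded by blast
  have "\<not> (\<exists>t'\<ge>T. t' \<in> update_times s)"
    using T by auto
  then have "nash_equilibrium I A u (s T)"
    using stall s_in unfolding nash_equilibrium_iff_no_better_response never_stalls_def by blast
  moreover have "s t = s T" if "T \<le> t" for t
    using that
  proof (induction t rule: dec_induct)
    case base
    show ?case ..
  next
    case (step t)
    then have "t \<notin> update_times s"
      using T by (meson leD)
    then show ?case
      using step.IH unfolding update_times_def by simp
  qed
  ultimately show "\<exists>T. nash_equilibrium I A u (s T) \<and> (\<forall>t\<ge>T. s t = s T)"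
    by blast
qed

text \<open>The double sum runs over ordered pairs, so each edge of a symmetric graph is counted
  twice; hence the division by 2. The private values carry the factor \<open>w i\<close> to match
  the interaction term \<open>w i * w j\<close>.\<close>

definition congestion_potential ::
  "'i set \<Rightarrow> ('i \<Rightarrow> 'i set) \<Rightarrow> ('i \<Rightarrow> real) \<Rightarrow> ('i \<Rightarrow> 'a \<Rightarrow> real) \<Rightarrow> ('i \<Rightarrow> 'a) \<Rightarrow> real" where
  "congestion_potential I nb w c a =
     (\<Sum>i\<in>I. w i * c i (a i)) -
     (\<Sum>i\<in>I. \<Sum>j\<in>I. if j \<in> nb i \<and> a j = a i then w i * w j else 0) / 2"

text \<open>The potential splits into \<open>w n * u\<close> and a remainder that does not depend on
  the action of \<open>n\<close>, so only the first part changes.\<close>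

lemma congestion_potential_update:
  fixes w :: "'i \<Rightarrow> real" and c :: "'i \<Rightarrow> 'a \<Rightarrow> real"
  assumes fin: "finite I" and n: "n \<in> I"
    and nb_sub: "nb n \<subseteq> I"
    and irrefl: "\<And>i. i \<in> I \<Longrightarrow> i \<notin> nb i"
    and sym: "\<And>i j. i \<in> I \<Longrightarrow> j \<in> I \<Longrightarrow> j \<in> nb i \<longleftrightarrow> i \<in> nb j"
  defines "u \<equiv> \<lambda>a. c n (a n) - (\<Sum>i\<in>{i \<in> nb n. a i = a n}. w i)"
  shows "congestion_potential I nb w c (a(n := x)) - congestion_potential I nb w c a =
         w n * (u (a(n := x)) - u a)"
proof -
  define J where "J = I - {n}"
  \<comment> \<open>This is the potential of the game with player \<open>n\<close> removed.\<close>
  define rest where "rest = (\<lambda>a. (\<Sum>i\<in>J. w i * c i (a i)) -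
     (\<Sum>i\<in>J. \<Sum>j\<in>J. if j \<in> nb i \<and> a j = a i then w i * w j else 0) / 2)"
  have split: "congestion_potential I nb w c b = w n * u b + rest b" for b
  proof -
    define g where "g = (\<lambda>i j. if j \<in> nb i \<and> b j = b i then w i * w j else 0)"
    have I: "I = insert n J" and J: "finite J" "n \<notin> J"
      using n fin unfolding J_def by auto
    have g_sym: "g i n = g n i" if "i \<in> J" for i
      using sym[of i n] n that unfolding g_def J_def by auto
    have g_irrefl: "g n n = 0"
      using irrefl n unfolding g_def by auto
    \<comment> \<open>Row and column of \<open>n\<close> are split off. The diagonal entry vanishes
      and symmetry makes row and column equal, giving the factor 2 that cancels the halving.\<close>
    have "(\<Sum>i\<in>I. \<Sum>j\<in>I. g i j) = g n n + (\<Sum>j\<in>J. g n j) + (\<Sum>i\<in>J. g i n + (\<Sum>j\<in>J. g i j))"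
      using J unfolding I by simp
    also have "\<dots> = 2 * (\<Sum>j\<in>J. g n j) + (\<Sum>i\<in>J. \<Sum>j\<in>J. g i j)"
      by (simp add: g_irrefl g_sym sum.distrib)
    finally have double: "(\<Sum>i\<in>I. \<Sum>j\<in>I. g i j) / 2 =
        (\<Sum>j\<in>J. g n j) + (\<Sum>i\<in>J. \<Sum>j\<in>J. g i j) / 2"
      by simp
    have eq: "{j \<in> J. j \<in> nb n \<and> b j = b n} = {i \<in> nb n. b i = b n}"
      using nb_sub irrefl[OF n] unfolding J_def by auto
    have "(\<Sum>j\<in>J. g n j) = (\<Sum>j\<in>{j \<in> J. j \<in> nb n \<and> b j = b n}. w n * w j)"
      unfolding g_def using J(1) by (simp add: sum.inter_filter)
    then have row: "(\<Sum>j\<in>J. g n j) = w n * (\<Sum>i\<in>{i \<in> nb n. b i = b n}. w i)"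
      unfolding eq by (simp add: sum_distrib_left)
    have lin: "(\<Sum>i\<in>I. w i * c i (b i)) = w n * c n (b n) + (\<Sum>i\<in>J. w i * c i (b i))"
      using J unfolding I by simp
    show ?thesis
      using double unfolding congestion_potential_def rest_def u_def lin g_def[symmetric]
      by (simp add: g_def row[unfolded g_def] algebra_simps)
  qed
  have "rest (a(n := x)) = rest a"
    unfolding rest_def J_def
    by (intro arg_cong2[where f = "(-)"] arg_cong2[where f = "(/)"] sum.cong refl) auto
  then show ?thesis
    unfolding split by (simp add: algebra_simps)
qed

lemma neighbors_sub: "neighbors N ds \<delta> d n \<subseteq> {1..N}"
  unfolding neighbors_def by blast

lemma neighbors_irrefl: "n \<notin> neighbors N ds \<delta> d n"
  unfolding neighbors_def interference_edges_def by (auto simp: doubleton_eq_iff)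

lemma neighbors_sym:
  assumes "i \<in> {1..N}" "j \<in> {1..N}"
  shows "j \<in> neighbors N ds \<delta> d i \<longleftrightarrow> i \<in> neighbors N ds \<delta> d j"
  using assms unfolding neighbors_def by (simp add: insert_commute)

text \<open>The logarithm turns the product of the factors \<open>1 - p i\<close> into a sum.
  Splitting it uses that the private factor and every \<open>1 - p i\<close> are positive.\<close>

lemma payoff_eq_value_minus_congestion:
  assumes pos: "\<theta> (a n) * B (a n) (d n) n * p n > 0"
    and p: "\<And>i. i \<in> {1..N} \<Longrightarrow> p i < 1"
  shows "payoff N ds \<delta> \<theta> B p d n a =
         ln (\<theta> (a n) * B (a n) (d n) n * p n) -
         (\<Sum>i\<in>{i \<in> neighbors N ds \<delta> d n. a i = a n}. - ln (1 - p i))"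
proof -
  let ?S = "{i \<in> neighbors N ds \<delta> d n. a i = a n}"
  have S: "finite ?S" "\<And>i. i \<in> ?S \<Longrightarrow> 0 < 1 - p i"
    using neighbors_sub[of N ds \<delta> d n] p by (auto intro: finite_subset)
  have "ln (\<theta> (a n) * B (a n) (d n) n * p n * (\<Prod>i\<in>?S. 1 - p i)) =
        ln (\<theta> (a n) * B (a n) (d n) n * p n) + ln (\<Prod>i\<in>?S. 1 - p i)"
    using pos prod_pos[of ?S "\<lambda>i. 1 - p i"] S(2) by (intro ln_mult_pos) blast+
  also have "ln (\<Prod>i\<in>?S. 1 - p i) = (\<Sum>i\<in>?S. ln (1 - p i))"
    using S by (intro ln_prod) force+
  finally show ?thesis
    unfolding payoff_def cochannel_neighbors_def by (simp add: sum_negf)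
qed

theorem theorem1:
  fixes N M :: nat
    and \<Delta> :: "'l set"
    and ds :: "'l \<Rightarrow> 'l \<Rightarrow> real"
    and \<delta> p_min p_max :: real
    and \<theta> p :: "nat \<Rightarrow> real"
    and B :: "nat \<Rightarrow> 'l \<Rightarrow> nat \<Rightarrow> real"
    and d :: "nat \<Rightarrow> 'l"
  assumes "N \<ge> 1" and "M \<ge> 1"
    and "finite \<Delta>" and "Metric_space \<Delta> ds"
    and "\<And>m. m \<in> {1..M} \<Longrightarrow> \<theta> m \<in> {0<..<1}"
    and "\<And>m l n. m \<in> {1..M} \<Longrightarrow> l \<in> \<Delta> \<Longrightarrow> n \<in> {1..N} \<Longrightarrow> B m l n > 0"
    and "0 < p_min" and "p_min < p_max" and "p_max < 1"
    and "\<And>n. n \<in> {1..N} \<Longrightarrow> p n \<in> {p_min<..<p_max}"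
    and "d \<in> {1..N} \<rightarrow>\<^sub>E \<Delta>"
  shows "(\<exists>a. nash_equilibrium {1..N} (\<lambda>_. {1..M}) (payoff N ds \<delta> \<theta> B p d) a) \<and>
         finite_improvement_property {1..N} (\<lambda>_. {1..M}) (payoff N ds \<delta> \<theta> B p d)"
proof -
  let ?I = "{1..N}" and ?A = "\<lambda>_::nat. {1..M}" and ?u = "payoff N ds \<delta> \<theta> B p d"
  define w where "w = (\<lambda>i. - ln (1 - p i))"
  define c where "c = (\<lambda>n m. ln (\<theta> m * B m (d n) n * p n))"
  define \<Phi> where "\<Phi> = congestion_potential ?I (neighbors N ds \<delta> d) w c"
  have p: "0 < p n" "p n < 1" if "n \<in> ?I" for n
    using assms(10)[OF that] assms(7,9) by auto
  \<comment> \<open>Restricted to profiles: \<theta> and \<open>B\<close> are known to be positive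
    only for channels in \<open>{1..M}\<close>.\<close>
  have u: "?u n a = c n (a n) - (\<Sum>i\<in>{i \<in> neighbors N ds \<delta> d n. a i = a n}. w i)"
    if "n \<in> ?I" "a \<in> Pi\<^sub>E ?I ?A" for n a
  proof -
    have "a n \<in> {1..M}" "d n \<in> \<Delta>"
      using that assms(11) by (auto simp: PiE_mem)
    then have "\<theta> (a n) * B (a n) (d n) n * p n > 0"
      using assms(5)[of "a n"] assms(6)[of "a n" "d n" n] p(1) that(1) by simp
    then show ?thesis
      unfolding w_def c_def using payoff_eq_value_minus_congestion p(2) by blast
  qed
  have incr: "\<Phi> a < \<Phi> b" if ab: "better_response_update ?I ?A ?u a b" for a b
  proof -
    obtain n x where n: "n \<in> ?I" and b: "b = a(n := x)" and less: "?u n a < ?u n b"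
      using ab unfolding better_response_update_def by (elim conjE bexE) (rule that)
    have a_in: "a \<in> Pi\<^sub>E ?I ?A"
      using ab unfolding better_response_update_def by (elim conjE)
    have b_in: "b \<in> Pi\<^sub>E ?I ?A"
      using ab by (rule better_response_update_in_PiE)
    have "\<Phi> b - \<Phi> a = w n * (?u n b - ?u n a)"
      unfolding \<Phi>_def b u[OF n a_in] u[OF n b_in[unfolded b]]
      by (rule congestion_potential_update[OF _ n neighbors_sub neighbors_irrefl neighbors_sym]) simp_all
    \<comment> \<open>As \<open>1 - p n\<close> lies strictly between 0 and 1, its logarithm is
      negative. A positive weight makes \<Phi> and the payoff of \<open>n\<close> change with the
      same sign.\<close>
    moreover have "w n > 0"
      unfolding w_def using p[OF n] by simp
    ultimately show ?thesis
      using less by (smt (verit) mult_pos_pos)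
  qed
  have fin: "finite (Pi\<^sub>E ?I ?A)"
    by (intro finite_PiE) auto
  \<comment> \<open>At least one channel exists, so every player has an action.\<close>
  have ne: "Pi\<^sub>E ?I ?A \<noteq> {}"
    using assms(2) by (simp add: PiE_eq_empty_iff)
  show ?thesis
  proof (rule conjI)
    show "\<exists>a. nash_equilibrium ?I ?A ?u a"
      using fin ne incr by (rule nash_equilibrium_exists_of_potential)
    show "finite_improvement_property ?I ?A ?u"
      using fin incr by (rule finite_improvement_property_of_potential)
  qed
qed

end
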